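(* Let $a_0^{[0]},a_0^{[1]},a_1^{[1]},a_0^{[3]},a_1^{[3]},a_2^{[3]}\in\mathbb C$ with $a_1^{[1]}\ne0$, put $$a_0(x)=a_0^{[0]},\quad a_1(x)=a_0^{[1]}+a_1^{[1]}x,\quad a_2(x)=0,\quad a_3(x)=a_0^{[3]}+a_1^{[3]}x+a_2^{[3]}x^2,$$ $$J=a_0(x)I+a_1(x)D+\frac{a_3(x)}{3!}D^3,\qquad \lambda_n^{[0]}=a_0^{[0]}+n\,a_1^{[1]}\quad(n\ge0),$$ and assume $\lambda_n^{[0]}\neq0$ for all $n\ge0$. Consider the numbers $$\beta_n=-\frac{a_2^{[3]}}{2a_1^{[1]}}(n-1)n-\frac{a_0^{[1]}}{a_1^{[1]}},\quad n\ge0,$$ $$\alpha_n=-\frac{a_1^{[3]}}{2a_1^{[1]}}+\frac{a_0^{[1]}a_2^{[3]}}{(a_1^{[1]})^2}+(n-2)\left(-\frac{3a_1^{[3]}}{4a_1^{[1]}}+\frac{a_2^{[3]}\left(9a_0^{[1]}+a_2^{[3]}\right)}{6(a_1^{[1]})^2}\right)+(n-2)^2\left(b_0+b_1(n-2)+b_2(n-2)^2\right),\quad n\ge1,$$ $$\gamma_n=-\frac{1}{3a_1^{[1]}}\left(a_0^{[3]}+\frac{a_0^{[1]}\left(-a_1^{[1]}a_1^{[3]}+a_0^{[1]}a_2^{[3]}\right)}{(a_1^{[1]})^2}\right)-(n-1)\,\frac{(a_1^{[1]})^2a_0^{[3]}-a_0^{[1]}a_1^{[1]}a_1^{[3]}+(a_0^{[1]})^2a_2^{[3]}}{2(a_1^{[1]})^3}$$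 $$\qquad+(n-1)^2\left(f_0+f_1(n-1)+f_2(n-1)^2+f_3(n-1)^3+f_4(n-1)^4\right),\quad n\ge1,$$ where $$f_0=\frac{-18a_0^{[3]}(a_1^{[1]})^2+6a_1^{[3]}a_1^{[1]}\left(3a_0^{[1]}+a_2^{[3]}\right)+a_2^{[3]}\left(-18(a_0^{[1]})^2-12a_2^{[3]}a_0^{[1]}+(a_2^{[3]})^2\right)}{108(a_1^{[1]})^3},$$ $$f_1=\frac{a_2^{[3]}\left(6a_1^{[1]}a_1^{[3]}+a_2^{[3]}\left(a_2^{[3]}-12a_0^{[1]}\right)\right)}{72(a_1^{[1]})^3},$$ $$f_2=-\frac{a_2^{[3]}\left(a_2^{[3]}\left(12a_0^{[1]}+a_2^{[3]}\right)-6a_1^{[1]}a_1^{[3]}\right)}{216(a_1^{[1]})^3},\quad f_3=-\frac{(a_2^{[3]})^3}{72(a_1^{[1]})^3},\quad f_4=-\frac{(a_2^{[3]})^3}{216(a_1^{[1]})^3},$$ $$b_0=\frac12\left(-\frac{a_1^{[3]}}{2a_1^{[1]}}+\frac{a_0^{[1]}a_2^{[3]}}{(a_1^{[1]})^2}+\frac{10(a_2^{[3]})^2}{12(a_1^{[1]})^2}\right),\quad b_1=\frac{(a_2^{[3]})^2}{3(a_1^{[1]})^2},\quad b_2=\frac{(a_2^{[3]})^2}{12(a_1^{[1]})^2}.$$ (i) If $\{P_n\}_{n\ge0}$ is a monic $2$-orthogonal polynomial sequence satisfying $J(P_n(x))=\lambda_n^{[0]}P_n(x)$ for all $n\ge0$,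 then $$(a_1^{[3]})^2-4a_2^{[3]}a_0^{[3]}=0$$ and the recurrence coefficients of $\{P_n\}_{n\ge0}$ are the numbers $\beta_n$ $(n\ge0)$, $\alpha_n$ $(n\ge1)$, $\gamma_n$ $(n\ge1)$ displayed above. (ii) Conversely, if $(a_1^{[3]})^2-4a_2^{[3]}a_0^{[3]}=0$ and the numbers $\gamma_n$ displayed above satisfy $\gamma_n\ne0$ for all $n\ge1$, then the $2$-orthogonal polynomial sequence $\{P_n\}_{n\ge0}$ defined by the recurrence coefficients $\beta_n,\alpha_n,\gamma_n$ displayed above satisfies $J(P_n(x))=\lambda_n^{[0]}P_n(x)$ for all $n\ge0$.
   Context: $D=d/dx$ and $I$ is the identity on the space of complex polynomials. A monic polynomial sequence is a sequence $\{P_n\}_{n\ge0}$ of monic polynomials over $\mathbb C$ with $\deg P_n=n$; its dual sequence $\{u_n\}_{n\ge0}$ is the sequence of linear functionals on polynomials with $\langle u_n,P_m\rangle=\delta_{n,m}$. The sequence is $2$-orthogonal (with respect to $(u_0,u_1)$) if for $\nu=0,1$ and all $m\ge0$: $\langle u_\nu,P_mP_n\rangle=0$ for $n\ge 2m+\nu+1$, and $\langle u_\nu,P_mP_{2m+\nu}\rangle\ne0$. Equivalently (a known theorem), there are complex numbers $\{\beta_n\}_{n\ge0}$, $\{\alpha_n\}_{n\ge1}$, $\{\gamma_n\}_{n\ge1}$ (the recurrence coefficients) with $\gamma_n\neq0$ for all $n\ge1$ such that $P_0(x)=1$, $P_1(x)=x-\beta_0$, $P_2(x)=(x-\beta_1)P_1(x)-\alpha_1$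 and $$P_{n+3}(x)=(x-\beta_{n+2})P_{n+2}(x)-\alpha_{n+2}P_{n+1}(x)-\gamma_{n+1}P_n(x),\quad n\ge0.$$ *)

theory Defs
  imports Complex_Main "HOL-Computational_Algebra.Polynomial"
begin

definition monic_poly_seq :: "(nat \<Rightarrow> complex poly) \<Rightarrow> bool" where
  "monic_poly_seq P \<longleftrightarrow> (\<forall>n. degree (P n) = n \<and> lead_coeff (P n) = 1)"

definition dual_sequence :: "(nat \<Rightarrow> complex poly \<Rightarrow> complex) \<Rightarrow> (nat \<Rightarrow> complex poly) \<Rightarrow> bool" where
  "dual_sequence u P \<longleftrightarrow>
     (\<forall>n. Vector_Spaces.linear smult (*) (u n)) \<and>
     (\<forall>n m. u n (P m) = (if n = m then 1 else 0))"

text \<open>The functionals \<open>u 0\<close>, \<open>u 1\<close> in the orthogonality conditions are members of the dual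
  sequence, which exists and is unique for every monic polynomial sequence.\<close>

definition two_orthogonal :: "(nat \<Rightarrow> complex poly) \<Rightarrow> bool" where
  "two_orthogonal P \<longleftrightarrow> monic_poly_seq P \<and>
     (\<exists>u. dual_sequence u P \<and>
       (\<forall>\<nu>\<in>{0, 1}. \<forall>m.
          (\<forall>n\<ge>2 * m + \<nu> + 1. u \<nu> (P m * P n) = 0) \<and>
          u \<nu> (P m * P (2 * m + \<nu>)) \<noteq> 0))"

text \<open>The values \<open>\<alpha> 0\<close> and \<open>\<gamma> 0\<close> are not used. Nonvanishing of \<open>\<gamma>\<close> is not part of this predicate.\<close>

definition has_recurrence ::
    "(nat \<Rightarrow> complex poly) \<Rightarrow> (nat \<Rightarrow> complex) \<Rightarrow> (nat \<Rightarrow> complex) \<Rightarrow> (nat \<Rightarrow> complex) \<Rightarrow> bool" where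
  "has_recurrence P \<beta> \<alpha> \<gamma> \<longleftrightarrow>
     P 0 = 1 \<and>
     P 1 = [:- \<beta> 0, 1:] \<and>
     P 2 = [:- \<beta> 1, 1:] * P 1 - [:\<alpha> 1:] \<and>
     (\<forall>n. P (n + 3) = [:- \<beta> (n + 2), 1:] * P (n + 2)
            - smult (\<alpha> (n + 2)) (P (n + 1)) - smult (\<gamma> (n + 1)) (P n))"

text \<open>\<open>a0 I + a1 D + (a3 / 3!) D^3\<close>, acting on polynomials.\<close>

definition J_op :: "complex poly \<Rightarrow> complex poly \<Rightarrow> complex poly \<Rightarrow> complex poly \<Rightarrow> complex poly" where
  "J_op a0 a1 a3 p = a0 * p + a1 * pderiv p + smult (1 / fact 3) (a3 * (pderiv ^^ 3) p)"

text \<open>Below, the parameter \<open>aij\<close> is the coefficient of \<open>x^i\<close> in the polynomial \<open>a_j\<close>.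
  The index \<open>n\<close> is cast to the complex numbers before any subtraction.\<close>

definition lam :: "complex \<Rightarrow> complex \<Rightarrow> nat \<Rightarrow> complex" where
  "lam a00 a11 n = a00 + of_nat n * a11"

definition beta_coeff :: "complex \<Rightarrow> complex \<Rightarrow> complex \<Rightarrow> nat \<Rightarrow> complex" where
  "beta_coeff a01 a11 a23 n =
     - (a23 / (2 * a11)) * (of_nat n - 1) * of_nat n - a01 / a11"

definition alpha_coeff :: "complex \<Rightarrow> complex \<Rightarrow> complex \<Rightarrow> complex \<Rightarrow> nat \<Rightarrow> complex" where
  "alpha_coeff a01 a11 a13 a23 n =
    (let k = of_nat n - 2;
         b0 = 1 / 2 * (- (a13 / (2 * a11)) + a01 * a23 / a11^2 + 10 * a23^2 / (12 * a11^2));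
         b1 = a23^2 / (3 * a11^2);
         b2 = a23^2 / (12 * a11^2)
     in - (a13 / (2 * a11)) + a01 * a23 / a11^2
        + k * (- (3 * a13 / (4 * a11)) + a23 * (9 * a01 + a23) / (6 * a11^2))
        + k^2 * (b0 + b1 * k + b2 * k^2))"

definition gamma_coeff ::
    "complex \<Rightarrow> complex \<Rightarrow> complex \<Rightarrow> complex \<Rightarrow> complex \<Rightarrow> nat \<Rightarrow> complex" where
  "gamma_coeff a01 a11 a03 a13 a23 n =
    (let k = of_nat n - 1;
         f0 = (- 18 * a03 * a11^2 + 6 * a13 * a11 * (3 * a01 + a23)
               + a23 * (- 18 * a01^2 - 12 * a23 * a01 + a23^2)) / (108 * a11^3);
         f1 = a23 * (6 * a11 * a13 + a23 * (a23 - 12 * a01)) / (72 * a11^3);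
         f2 = - (a23 * (a23 * (12 * a01 + a23) - 6 * a11 * a13) / (216 * a11^3));
         f3 = - (a23^3 / (72 * a11^3));
         f4 = - (a23^3 / (216 * a11^3))
     in - (1 / (3 * a11)) * (a03 + a01 * (- a11 * a13 + a01 * a23) / a11^2)
        - k * ((a11^2 * a03 - a01 * a11 * a13 + a01^2 * a23) / (2 * a11^3))
        + k^2 * (f0 + f1 * k + f2 * k^2 + f3 * k^3 + f4 * k^4))"

end

theory Submission
  imports Defs
begin

text \<open>Write \<open>y = x + u\<close> with \<open>u = a01 / a11\<close>, and expand \<open>a\<^sub>3 / a11 = c0 + c1 y + c2 y\<^sup>2\<close>. The eigenvalue
  equation becomes \<open>y P' + (c0 + c1 y + c2 y\<^sup>2) P''' / 6 = n P\<close>.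

  In one direction, it determines the three coefficients of \<open>P\<^sub>n\<close> after the leading one as polynomials
  in \<open>n\<close>, and comparing coefficients in the recurrence gives \<open>\<beta>\<^sub>n\<close>, \<open>\<alpha>\<^sub>n\<close> and \<open>\<gamma>\<^sub>n\<close>. The first
  comparison that is not used up in this way and does not hold automatically (the linear coefficient
  of \<open>y P\<^sub>4\<close>) says that \<open>c1\<^sup>2 = 4 c0 c2\<close>.

  Conversely, \<open>c1\<^sup>2 = 4 c0 c2\<close> makes the coefficient of \<open>P''' / 6\<close> a square \<open>(p y + q)\<^sup>2\<close>. With
  \<open>r(t) = q - p\<^sup>3 t (t - 1) / 6\<close> the recurrence reads
  \<open>y P\<^sub>n = P\<^sub>n\<^sub>+\<^sub>1 - n (n - 1) / 6 (3 p\<^sup>2 P\<^sub>n + 3 p r(n - 1) P\<^sub>n\<^sub>-\<^sub>1 + r(n - 1) r(n - 2) P\<^sub>n\<^sub>-\<^sub>2)\<close>, and induction on \<open>n\<close> gives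
  the first order relation \<open>(p y + q) P\<^sub>n' = n (p P\<^sub>n + r(n - 1) P\<^sub>n\<^sub>-\<^sub>1)\<close>. Applying it twice
  expresses \<open>(p y + q)\<^sup>2 P\<^sub>n''\<close> through \<open>P\<^sub>n, P\<^sub>n\<^sub>-\<^sub>1, P\<^sub>n\<^sub>-\<^sub>2\<close>. Up to the factor 2 this is the commutator of
  the third order term with multiplication by \<open>y\<close>, so a second induction along the recurrence proves
  the eigenvalue equation.\<close>

subsection \<open>Duality and the recurrence relation\<close>

lemma vector_space_smult: "vector_space (smult :: 'a::field \<Rightarrow> 'a poly \<Rightarrow> 'a poly)"
  by unfold_locales (auto simp: smult_add_right smult_add_left)

lemma vector_space_times: "vector_space ((*) :: 'a::field \<Rightarrow> 'a \<Rightarrow> 'a)"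
  by unfold_locales (auto simp: algebra_simps)

lemma monic_poly_seqD:
  assumes "monic_poly_seq P"
  shows "degree (P n) = n" "coeff (P n) n = 1"
  using assms unfolding monic_poly_seq_def by (metis, metis)

lemma monic_poly_seq_expansion:
  assumes P: "monic_poly_seq P"
  shows "degree q \<le> n \<Longrightarrow> \<exists>c. q = (\<Sum>k\<le>n. smult (c k) (P k))"
proof (induction n arbitrary: q)
  case 0
  then obtain a where "q = [:a:]" by (metis degree_eq_zeroE le_zero_eq)
  moreover obtain b where "P 0 = [:b:]" using monic_poly_seqD(1)[OF P, of 0] by (metis degree_eq_zeroE)
  ultimately show ?case using monic_poly_seqD(2)[OF P, of 0] by (intro exI[of _ "\<lambda>_. a"]) simp
next
  case (Suc n)
  define r where "r = q - smult (coeff q (Suc n)) (P (Suc n))"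
  have "degree r \<le> n"
  proof (rule degree_le, safe)
    fix i assume "n < i"
    then consider "i = Suc n" | "i > Suc n" by linarith
    then show "coeff r i = 0"
      using Suc.prems monic_poly_seqD[OF P, of "Suc n"] by cases (auto simp: r_def coeff_eq_0)
  qed
  then obtain c where c: "r = (\<Sum>k\<le>n. smult (c k) (P k))" using Suc.IH by blast
  have "q = (\<Sum>k\<le>Suc n. smult ((c(Suc n := coeff q (Suc n))) k) (P k))"
    using c unfolding r_def by (simp add: algebra_simps)
  then show ?case by blast
qed

text \<open>Polynomials of distinct degrees are linearly independent, so prescribed values on
  \<open>range P\<close> extend to a linear functional.\<close>

lemma dual_sequence_exists:
  assumes P: "monic_poly_seq P"
  obtains u where "dual_sequence u P"
proof -
  interpret vector_space_pair "smult :: complex \<Rightarrow> complex poly \<Rightarrow> complex poly" "(*) :: complex \<Rightarrow> complex \<Rightarrow> complex"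
    by (intro vector_space_pair.intro vector_space_smult vector_space_times)
  have inj: "inj P" using monic_poly_seqD(1)[OF P] by (metis injI)
  have "vs1.independent (range P)"
    unfolding vs1.independent_explicit_module
  proof (intro allI impI)
    fix t f v
    assume t: "finite t" "t \<subseteq> range P" and sum: "(\<Sum>w\<in>t. smult (f w) w) = 0" and v: "v \<in> t"
    define T where "T = {w \<in> t. f w \<noteq> 0}"
    have T: "finite T" "T \<subseteq> range P" using t by (auto simp: T_def)
    have "T = {}"
    proof (rule ccontr)
      assume "T \<noteq> {}"
      \<comment> \<open>In a vanishing combination, the coefficient of x^N at the largest degree N
        that occurs comes from \<open>P N\<close> alone.\<close>
      define N where "N = Max (degree ` T)"
      have "N \<in> degree ` T" using T \<open>T \<noteq> {}\<close> unfolding N_def by (intro Max_in) auto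
      then have N: "P N \<in> T" using T(2) monic_poly_seqD(1)[OF P] by auto
      have le: "degree w \<le> N" if "w \<in> T" for w using that T(1) unfolding N_def by auto
      have "0 = coeff (\<Sum>w\<in>T. smult (f w) w) N"
        using sum sum.mono_neutral_left[OF t(1), of T "\<lambda>w. smult (f w) w"] by (simp add: T_def)
      also have "\<dots> = (\<Sum>w\<in>T. if w = P N then f w else 0)"
        unfolding coeff_sum
      proof (rule sum.cong[OF refl])
        fix w assume w: "w \<in> T"
        then obtain k where k: "w = P k" using T(2) by auto
        have "k \<le> N" using le[OF w] monic_poly_seqD(1)[OF P] k by simp
        then show "coeff (smult (f w) w) N = (if w = P N then f w else 0)"
          using k monic_poly_seqD[OF P] inj by (auto simp: inj_eq coeff_eq_0 le_less)
      qed
      also have "\<dots> = f (P N)" using N T(1) by simp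
      finally show False using N by (simp add: T_def)
    qed
    then show "f v = 0" using v by (auto simp: T_def)
  qed
  then have "\<exists>g. Vector_Spaces.linear smult (*) g \<and> (\<forall>q\<in>range P. g q = (if q = P n then 1 else 0))" for n
    by (rule linear_independent_extend)
  then obtain u where "\<And>n. Vector_Spaces.linear smult (*) (u n) \<and> (\<forall>q\<in>range P. u n q = (if q = P n then 1 else 0))"
    by metis
  then have "dual_sequence u P" unfolding dual_sequence_def using inj by (auto simp: inj_eq)
  then show thesis by (rule that)
qed

text \<open>Since \<open>pCons 0 p\<close> is x p, the recurrence expands x \<open>P n\<close> in
  the basis \<open>P\<close>; the initial conditions become the cases in which terms of negative
  index are dropped.\<close>

lemma has_recurrence_iff:
  "has_recurrence P \<beta> \<alpha> \<gamma> \<longleftrightarrow> P 0 = 1 \<and>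
    (\<forall>n. pCons 0 (P n) = P (Suc n) + smult (\<beta> n) (P n)
       + (if n = 0 then 0 else smult (\<alpha> n) (P (n - 1)))
       + (if n \<le> 1 then 0 else smult (\<gamma> (n - 1)) (P (n - 2))))"
proof -
  define R where "R n \<longleftrightarrow> pCons 0 (P n) = P (Suc n) + smult (\<beta> n) (P n)
       + (if n = 0 then 0 else smult (\<alpha> n) (P (n - 1)))
       + (if n \<le> 1 then 0 else smult (\<gamma> (n - 1)) (P (n - 2)))" for n
  have 0: "R 0 \<longleftrightarrow> P 1 = [:- \<beta> 0, 1:]" if "P 0 = 1"
  proof -
    have "[:- \<beta> 0, 1:] = pCons 0 (P 0) - smult (\<beta> 0) (P 0)" using that by (simp add: one_pCons)
    then show ?thesis unfolding eq_diff_eq R_def by auto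
  qed
  have 1: "R 1 \<longleftrightarrow> P 2 = [:- \<beta> 1, 1:] * P 1 - [:\<alpha> 1:]" if "P 0 = 1"
    using that unfolding R_def by (auto simp: algebra_simps one_pCons numeral_2_eq_2)
  have 2: "R (n + 2) \<longleftrightarrow> P (n + 3) = [:- \<beta> (n + 2), 1:] * P (n + 2)
            - smult (\<alpha> (n + 2)) (P (n + 1)) - smult (\<gamma> (n + 1)) (P n)" for n
    unfolding R_def by (auto simp: algebra_simps numeral_2_eq_2 numeral_3_eq_3)
  have "n = 0 \<or> n = 1 \<or> n = (n - 2) + 2" for n :: nat by arith
  then have "(\<forall>n. R n) \<longleftrightarrow> R 0 \<and> R 1 \<and> (\<forall>n. R (n + 2))" by metis
  then show ?thesis
    unfolding has_recurrence_def R_def[symmetric] by (simp only: 2[symmetric]) (metis 0 1)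
qed

lemma has_recurrence_cong:
  assumes "\<And>n. \<beta> n = \<beta>' n" "\<And>n. n \<ge> 1 \<Longrightarrow> \<alpha> n = \<alpha>' n" "\<And>n. n \<ge> 1 \<Longrightarrow> \<gamma> n = \<gamma>' n"
  shows "has_recurrence P \<beta> \<alpha> \<gamma> \<longleftrightarrow> has_recurrence P \<beta>' \<alpha>' \<gamma>'"
  unfolding has_recurrence_def using assms by simp

fun rec_polys :: "(nat \<Rightarrow> complex) \<Rightarrow> (nat \<Rightarrow> complex) \<Rightarrow> (nat \<Rightarrow> complex) \<Rightarrow> nat \<Rightarrow> complex poly" where
  "rec_polys \<beta> \<alpha> \<gamma> 0 = 1"
| "rec_polys \<beta> \<alpha> \<gamma> (Suc 0) = [:- \<beta> 0, 1:]"
| "rec_polys \<beta> \<alpha> \<gamma> (Suc (Suc 0)) = [:- \<beta> 1, 1:] * [:- \<beta> 0, 1:] - [:\<alpha> 1:]"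
| "rec_polys \<beta> \<alpha> \<gamma> (Suc (Suc (Suc n))) = [:- \<beta> (n + 2), 1:] * rec_polys \<beta> \<alpha> \<gamma> (Suc (Suc n))
     - smult (\<alpha> (n + 2)) (rec_polys \<beta> \<alpha> \<gamma> (Suc n)) - smult (\<gamma> (n + 1)) (rec_polys \<beta> \<alpha> \<gamma> n)"

text \<open>This yields the existence and uniqueness claimed in the converse.\<close>

lemma has_recurrence_iff_rec_polys: "has_recurrence P \<beta> \<alpha> \<gamma> \<longleftrightarrow> P = rec_polys \<beta> \<alpha> \<gamma>"
proof
  assume P: "has_recurrence P \<beta> \<alpha> \<gamma>"
  show "P = rec_polys \<beta> \<alpha> \<gamma>"
  proof
    fix n show "P n = rec_polys \<beta> \<alpha> \<gamma> n"
      using P by (induction \<beta> \<alpha> \<gamma> n rule: rec_polys.induct)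
        (simp_all add: has_recurrence_def numeral_2_eq_2 numeral_3_eq_3)
  qed
next
  assume "P = rec_polys \<beta> \<alpha> \<gamma>"
  then show "has_recurrence P \<beta> \<alpha> \<gamma>"
    by (simp add: has_recurrence_def numeral_2_eq_2 numeral_3_eq_3)
qed

lemma degree_lead_coeff_pCons_diff:
  fixes p q :: "'a::comm_ring_1 poly"
  assumes "degree p = n" "coeff p n = 1" "degree q \<le> n"
  shows "degree (pCons 0 p - q) = Suc n \<and> coeff (pCons 0 p - q) (Suc n) = 1"
proof -
  have c: "coeff (pCons 0 p - q) (Suc n) = 1" using assms by (simp add: coeff_eq_0)
  have "degree (pCons 0 p - q) \<le> Suc n"
    using assms degree_pCons_le[of 0 p] by (intro degree_diff_le) auto
  moreover have "degree (pCons 0 p - q) \<ge> Suc n" using c by (intro le_degree) simp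
  ultimately show ?thesis using c by simp
qed

lemma has_recurrence_monic:
  assumes "has_recurrence P \<beta> \<alpha> \<gamma>"
  shows "monic_poly_seq P"
proof -
  have rec: "P (Suc n) = pCons 0 (P n) - (smult (\<beta> n) (P n)
       + (if n = 0 then 0 else smult (\<alpha> n) (P (n - 1)))
       + (if n \<le> 1 then 0 else smult (\<gamma> (n - 1)) (P (n - 2))))"
    and P0: "P 0 = 1" for n
    using assms unfolding has_recurrence_iff by (simp_all add: algebra_simps)
  have "degree (P n) = n \<and> coeff (P n) n = 1" for n
  proof (induction n rule: less_induct)
    case (less n)
    show ?case
    proof (cases n)
      case 0
      then show ?thesis using P0 by simp
    next
      case (Suc m)
      have deg: "degree (smult a (P k)) \<le> m" if "k \<le> m" for a k
        using less.IH[of k] that Suc degree_smult_le[of a "P k"] by simp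
      show ?thesis unfolding Suc rec[of m]
        using less.IH[of m] Suc deg
        by (intro degree_lead_coeff_pCons_diff degree_add_le) auto
    qed
  qed
  then show ?thesis by (simp add: monic_poly_seq_def)
qed

section \<open>Equivalence of 2-orthogonality and the recurrence\<close>

lemma dual_sequence_linear:
  assumes "dual_sequence u P"
  shows "u n (p + q) = u n p + u n q" "u n (smult a p) = a * u n p"
    "u n 0 = 0" "u n (sum f A) = (\<Sum>k\<in>A. u n (f k))"
proof -
  interpret Vector_Spaces.linear "smult :: complex \<Rightarrow> complex poly \<Rightarrow> complex poly" "(*)" "u n"
    using assms by (simp add: dual_sequence_def)
  show "u n (p + q) = u n p + u n q" "u n (smult a p) = a * u n p"
    "u n 0 = 0" "u n (sum f A) = (\<Sum>k\<in>A. u n (f k))"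
    by (simp_all add: add scale sum)
qed

text \<open>Applying \<open>u j\<close> to an expansion in \<open>P\<close> isolates its j-th
  coefficient.\<close>

lemma dual_sequence_expansion:
  assumes P: "monic_poly_seq P" and u: "dual_sequence u P" and q: "degree q \<le> n"
  shows "q = (\<Sum>k\<le>n. smult (u k q) (P k))"
proof -
  obtain c where c: "q = (\<Sum>k\<le>n. smult (c k) (P k))"
    using monic_poly_seq_expansion[OF P q] by blast
  have "u j q = c j" if "j \<le> n" for j
  proof -
    have "u j q = (\<Sum>k\<le>n. c k * u j (P k))"
      unfolding c by (simp add: dual_sequence_linear[OF u])
    also have "\<dots> = (\<Sum>k\<le>n. if j = k then c k else 0)"
      using u by (intro sum.cong) (auto simp: dual_sequence_def)
    also have "\<dots> = c j" using that by simp
    finally show ?thesis .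
  qed
  then have "(\<Sum>k\<le>n. smult (u k q) (P k)) = (\<Sum>k\<le>n. smult (c k) (P k))" by simp
  then show ?thesis using c by simp
qed

text \<open>A factor x moved from q onto \<open>P n\<close> lowers the index n by at most 2.
  Induction on the degree of q therefore gives the thresholds 2 m + \<nu>.\<close>

lemma has_recurrence_imp_two_orthogonal:
  assumes rec: "has_recurrence P \<beta> \<alpha> \<gamma>" and \<gamma>: "\<And>n. n \<ge> 1 \<Longrightarrow> \<gamma> n \<noteq> 0"
  shows "two_orthogonal P"
proof -
  have P: "monic_poly_seq P" by (rule has_recurrence_monic[OF rec])
  obtain u where u: "dual_sequence u P" by (rule dual_sequence_exists[OF P])
  note lin = dual_sequence_linear[OF u]
  have uP: "u \<nu> (P n) = (if \<nu> = n then 1 else 0)" for \<nu> n using u by (simp add: dual_sequence_def)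
  have mult_x: "pCons 0 (P n) = P (Suc n) + smult (\<beta> n) (P n)
       + (if n = 0 then 0 else smult (\<alpha> n) (P (n - 1)))
       + (if n \<le> 1 then 0 else smult (\<gamma> (n - 1)) (P (n - 2)))" for n
    using rec unfolding has_recurrence_iff by blast
  have u_pCons: "u \<nu> (pCons a q * P n) = a * u \<nu> (P n) + u \<nu> (q * P (Suc n)) + \<beta> n * u \<nu> (q * P n)
     + \<alpha> n * u \<nu> (q * P (n - 1)) + \<gamma> (n - 1) * u \<nu> (q * P (n - 2))" if "n \<ge> 2" for \<nu> a q n
  proof -
    have "pCons a q * P n = smult a (P n) + q * pCons 0 (P n)"
      by simp
    also have "\<dots> = smult a (P n) + q * P (Suc n) + smult (\<beta> n) (q * P n)
     + smult (\<alpha> n) (q * P (n - 1)) + smult (\<gamma> (n - 1)) (q * P (n - 2))"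
      unfolding mult_x using that by (simp add: algebra_simps)
    finally show ?thesis by (simp add: lin)
  qed
  have zero: "u \<nu> (q * P n) = 0" if "degree q \<le> m" "n \<ge> 2 * m + \<nu> + 1" for \<nu> q m n
    using that
  proof (induction m arbitrary: q n)
    case 0
    then obtain a where "q = [:a:]" by (auto elim: degree_eq_zeroE)
    then show ?case using 0 by (simp add: lin uP)
  next
    case (Suc m)
    obtain a q' where q: "q = pCons a q'" by (rule pCons_cases)
    have "degree q' \<le> m" using Suc.prems(1) q by (auto split: if_splits)
    then show ?case unfolding q using Suc.prems(2) Suc.IH by (simp add: u_pCons uP del: mult_pCons_left)
  qed
  \<comment> \<open>At the boundary index only the \<gamma> term survives each reduction, so the
    value is \<open>coeff q m\<close> times a product of values of \<gamma>.\<close>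
  have nonzero: "u \<nu> (q * P (2 * m + \<nu>)) \<noteq> 0" if "degree q \<le> m" "coeff q m \<noteq> 0" for \<nu> q m
    using that
  proof (induction m arbitrary: q)
    case 0
    then obtain a where "q = [:a:]" by (auto elim: degree_eq_zeroE)
    then show ?case using 0 by (simp add: lin uP)
  next
    case (Suc m)
    obtain a q' where q: "q = pCons a q'" by (rule pCons_cases)
    have q': "degree q' \<le> m" "coeff q' m \<noteq> 0" using Suc.prems q by (auto split: if_splits)
    have "u \<nu> (q * P (2 * Suc m + \<nu>)) = \<gamma> (2 * m + \<nu> + 1) * u \<nu> (q' * P (2 * m + \<nu>))"
      unfolding q using zero[OF q'(1)] by (simp add: u_pCons uP del: mult_pCons_left)
    then show ?case using Suc.IH[OF q'] \<gamma>[of "2 * m + \<nu> + 1"] by simp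
  qed
  show ?thesis unfolding two_orthogonal_def
  proof (intro conjI P exI[of _ u] u ballI allI impI)
    fix \<nu> m n :: nat
    show "u \<nu> (P m * P n) = 0" if "2 * m + \<nu> + 1 \<le> n"
      using zero[of "P m" m] that monic_poly_seqD[OF P] by simp
    show "u \<nu> (P m * P (2 * m + \<nu>)) \<noteq> 0"
      using nonzero[of "P m" m] monic_poly_seqD[OF P] by simp
  qed
qed

text \<open>In the product of x, \<open>P m\<close> and \<open>P n\<close>, the factor x is expanded
  once together with \<open>P m\<close> and once together with \<open>P n\<close>. Comparing the two
  values under \<open>u \<nu>\<close> shows which coefficients of x \<open>P n\<close>
  vanish.\<close>

lemma two_orthogonal_imp_has_recurrence:
  assumes "two_orthogonal P"
  shows "\<exists>\<beta> \<alpha> \<gamma>. has_recurrence P \<beta> \<alpha> \<gamma> \<and> (\<forall>n\<ge>1. \<gamma> n \<noteq> 0)"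
proof -
  from assms obtain u where P: "monic_poly_seq P" and u: "dual_sequence u P"
    and *: "\<forall>\<nu>\<in>{0, 1}. \<forall>m. (\<forall>n\<ge>2 * m + \<nu> + 1. u \<nu> (P m * P n) = 0) \<and>
          u \<nu> (P m * P (2 * m + \<nu>)) \<noteq> 0"
    unfolding two_orthogonal_def by blast
  have orth: "u \<nu> (P m * P n) = 0" if "\<nu> < 2" "n \<ge> 2 * m + \<nu> + 1" for \<nu> m n
    using * that unfolding less_2_cases_iff One_nat_def by blast
  have nz: "u \<nu> (P m * P (2 * m + \<nu>)) \<noteq> 0" if "\<nu> < 2" for \<nu> m
    using * that unfolding less_2_cases_iff One_nat_def by blast
  note lin = dual_sequence_linear[OF u]
  define a where "a n k = u k (pCons 0 (P n))" for n k
  have expand: "pCons 0 (P n) = (\<Sum>k\<le>Suc n. smult (a n k) (P k))" for n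
    unfolding a_def
    using monic_poly_seqD(1)[OF P, of n] degree_pCons_le[of 0 "P n"]
    by (intro dual_sequence_expansion[OF P u]) simp
  have a_top: "a n (Suc n) = 1" for n
  proof -
    have "1 = coeff (pCons 0 (P n)) (Suc n)" using monic_poly_seqD[OF P] by simp
    also have "\<dots> = (\<Sum>k\<le>Suc n. if k = Suc n then a n k else 0)"
      unfolding expand coeff_sum
      using monic_poly_seqD[OF P] by (intro sum.cong) (auto simp: coeff_eq_0)
    finally show ?thesis by simp
  qed
  have left: "u \<nu> (P m * pCons 0 (P n)) = (\<Sum>k\<le>Suc m. a m k * u \<nu> (P k * P n))" for \<nu> m n
  proof -
    have "P m * pCons 0 (P n) = pCons 0 (P m) * P n" by simp
    then show ?thesis unfolding expand[of m] by (simp add: sum_distrib_right lin del: sum.atMost_Suc)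
  qed
  have right: "u \<nu> (P m * pCons 0 (P n)) = (\<Sum>k\<le>Suc n. a n k * u \<nu> (P m * P k))" for \<nu> m n
    unfolding expand[of n] by (simp add: sum_distrib_left lin del: sum.atMost_Suc)
  \<comment> \<open>Indices above 2 m + \<nu> drop out by orthogonality, those below by the third
    assumption.\<close>
  have right_single: "u \<nu> (P m * pCons 0 (P n)) = a n (2 * m + \<nu>) * u \<nu> (P m * P (2 * m + \<nu>))"
    if "\<nu> < 2" "2 * m + \<nu> \<le> Suc n" "\<And>j. j < 2 * m + \<nu> \<Longrightarrow> a n j = 0" for \<nu> m n
  proof -
    have "u \<nu> (P m * pCons 0 (P n)) =
        (\<Sum>k\<le>Suc n. if k = 2 * m + \<nu> then a n k * u \<nu> (P m * P k) else 0)"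
      unfolding right
    proof (rule sum.cong[OF refl])
      fix k
      show "a n k * u \<nu> (P m * P k) = (if k = 2 * m + \<nu> then a n k * u \<nu> (P m * P k) else 0)"
        using that(3)[of k] orth[OF that(1), of m k] by (cases k "2 * m + \<nu>" rule: linorder_cases) auto
    qed
    also have "\<dots> = a n (2 * m + \<nu>) * u \<nu> (P m * P (2 * m + \<nu>))" using that(2) by simp
    finally show ?thesis .
  qed
  \<comment> \<open>The parity of j selects the functional that detects the coefficient
    \<open>a n j\<close>.\<close>
  have index: "\<exists>m \<nu>. \<nu> < 2 \<and> j = 2 * m + \<nu>" for j :: nat
    by (intro exI[of _ "j div 2"] exI[of _ "j mod 2"]) simp
  have a_low: "a n j = 0" if "j + 2 < n" for n j
    using that
  proof (induction j rule: less_induct)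
    case (less j)
    obtain m \<nu> where j: "\<nu> < 2" "j = 2 * m + \<nu>" using index by blast
    have "a m k * u \<nu> (P k * P n) = 0" if "k \<le> Suc m" for k
      using orth[OF j(1), of k n] that j(2) less.prems by simp
    then have "u \<nu> (P m * pCons 0 (P n)) = 0" unfolding left by (intro sum.neutral) simp
    then show ?case using right_single[OF j(1), of m n] nz[OF j(1), of m] less j(2) by auto
  qed
  \<comment> \<open>For n = j + 2 the expansion of x \<open>P m\<close> contributes only its top
    term \<open>P (Suc m)\<close>, and there the functional is nonzero by \<open>nz\<close>.\<close>
  have a_nz: "a (j + 2) j \<noteq> 0" for j
  proof -
    obtain m \<nu> where j: "\<nu> < 2" "j = 2 * m + \<nu>" using index by blast
    have "(\<Sum>k\<le>m. a m k * u \<nu> (P k * P (j + 2))) = 0"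
      using orth[OF j(1), of _ "j + 2"] j(2) by (intro sum.neutral) simp
    then have "u \<nu> (P m * pCons 0 (P (j + 2))) = u \<nu> (P (Suc m) * P (2 * Suc m + \<nu>))"
      unfolding left by (simp add: a_top j(2))
    then show ?thesis
      using right_single[OF j(1), of m "j + 2"] nz[OF j(1), of "Suc m"] a_low j(2) by auto
  qed
  \<comment> \<open>The index \<open>n - 1 + 1\<close> makes the last coefficient an instance of
    \<open>\<lambda>n. a (n + 1) (n - 1)\<close> at \<open>n - 1\<close>.\<close>
  have "pCons 0 (P n) = P (Suc n) + smult (a n n) (P n)
       + (if n = 0 then 0 else smult (a n (n - 1)) (P (n - 1)))
       + (if n \<le> 1 then 0 else smult (a (n - 1 + 1) (n - 1 - 1)) (P (n - 2)))" for n
  proof -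
    consider "n = 0" | "n = 1" | m where "n = m + 2"
    proof -
      have "n = 0 \<or> n = 1 \<or> n = (n - 2) + 2" by arith
      then show thesis using that by blast
    qed
    then show ?thesis
    proof cases
      case (3 m)
      have "(\<Sum>k\<le>m. smult (a n k) (P k)) = (\<Sum>k\<le>m. if k = m then smult (a n k) (P k) else 0)"
        using a_low 3 by (intro sum.cong) auto
      also have "\<dots> = smult (a n m) (P m)" by simp
      finally show ?thesis
        using expand[of n] a_top[of n] 3 by simp
    qed (use expand[of n] a_top[of n] in simp_all)
  qed
  moreover have "P 0 = 1"
  proof -
    obtain c where "P 0 = [:c:]" using monic_poly_seqD(1)[OF P, of 0] by (elim degree_eq_zeroE)
    then show ?thesis using monic_poly_seqD(2)[OF P, of 0] by (simp add: one_pCons)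
  qed
  ultimately have "has_recurrence P (\<lambda>n. a n n) (\<lambda>n. a n (n - 1)) (\<lambda>n. a (n + 1) (n - 1))"
    unfolding has_recurrence_iff by blast
  moreover have "a (n + 1) (n - 1) \<noteq> 0" if "n \<ge> 1" for n
    using a_nz[of "n - 1"] that by simp
  ultimately show ?thesis by blast
qed

subsection \<open>From the recurrence to the differential equation\<close>

text \<open>The inductive step for \<open>(p y + q) P\<^sub>n' = n (p P\<^sub>n + r(n - 1) P\<^sub>n\<^sub>-\<^sub>1)\<close>, with \<open>f3, f2, f1, f0, f00\<close> and
  \<open>d3, d2, d1, d0\<close> the values of \<open>P\<^sub>n\<^sub>+\<^sub>1, \<dots>, P\<^sub>n\<^sub>-\<^sub>3\<close> and of \<open>P\<^sub>n\<^sub>+\<^sub>1', \<dots>, P\<^sub>n\<^sub>-\<^sub>2'\<close> at one point.\<close>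

lemma single_commutator_identity:
  fixes N p q Y f3 f2 f1 f0 f00 d3 d2 d1 d0 :: complex
  assumes r: "\<And>t. r t = q - p^3 * t * (t - 1) / 6"
    and rec: "Y * f2 = f3 - N * (N - 1) / 6 * (3 * p^2 * f2 + 3 * p * r (N - 1) * f1 + r (N - 1) * r (N - 2) * f0)"
    and rec': "Y * f1 = f2 - (N - 1) * (N - 2) / 6 * (3 * p^2 * f1 + 3 * p * r (N - 2) * f0 + r (N - 2) * r (N - 3) * f00)"
    and d3: "d3 = f2 + Y * d2 + N * (N - 1) / 6 * (3 * p^2 * d2 + 3 * p * r (N - 1) * d1 + r (N - 1) * r (N - 2) * d0)"
    and d2: "(p * Y + q) * d2 = N * (p * f2 + r (N - 1) * f1)"
    and d1: "(p * Y + q) * d1 = (N - 1) * (p * f1 + r (N - 2) * f0)"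
    and d0: "(p * Y + q) * d0 = (N - 2) * (p * f0 + r (N - 3) * f00)"
  shows "(p * Y + q) * d3 = (N + 1) * (p * f3 + r N * f2)"
proof -
  define k where "k = N * (N - 1) / 6"
  have "(p * Y + q) * d3 = p * (Y * f2) + q * f2 + Y * ((p * Y + q) * d2)
     + k * (3 * p^2 * ((p * Y + q) * d2) + 3 * p * r (N - 1) * ((p * Y + q) * d1)
     + r (N - 1) * r (N - 2) * ((p * Y + q) * d0))"
    unfolding d3 k_def[symmetric] by (simp add: algebra_simps)
  also have "\<dots> = p * (Y * f2) + q * f2 + N * (p * (Y * f2) + r (N - 1) * (Y * f1))
     + k * (3 * p^2 * (N * (p * f2 + r (N - 1) * f1)) + 3 * p * r (N - 1) * ((N - 1) * (p * f1 + r (N - 2) * f0))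
     + r (N - 1) * r (N - 2) * ((N - 2) * (p * f0 + r (N - 3) * f00)))"
    unfolding d2 d1 d0 by (simp add: algebra_simps)
  \<comment> \<open>Eliminating \<open>Y * f2\<close> and \<open>Y * f1\<close> leaves a polynomial
    identity in which \<open>f00\<close> cancels.\<close>
  also have "\<dots> = (N + 1) * (p * f3 + r N * f2)"
    unfolding rec rec' k_def r by (simp add: field_simps power2_eq_square power3_eq_cube)
  finally show ?thesis .
qed

text \<open>When the coefficient of \<open>P''' / 6\<close> is a perfect square \<open>(p y + q)\<^sup>2\<close> in \<open>y = x + u\<close>, the recurrence
  coefficients factor through the single quadratic \<open>r\<close>.\<close>

locale factored_recurrence =
  fixes P :: "nat \<Rightarrow> complex poly" and p q u :: complex
    and r :: "complex \<Rightarrow> complex" and \<kappa> :: "nat \<Rightarrow> complex"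
  assumes r_eq: "r t = q - p^3 * t * (t - 1) / 6"
    and \<kappa>_eq: "\<kappa> n = of_nat n * (of_nat n - 1) / 6"
    and P_0: "P 0 = 1"
    and P_Suc: "P (Suc n) = [:u, 1:] * P n + smult (\<kappa> n)
       (smult (3 * p^2) (P n) + smult (3 * p * r (of_nat n - 1)) (P (n - 1))
         + smult (r (of_nat n - 1) * r (of_nat n - 2)) (P (n - 2)))"
begin

text \<open>These zeros remove the terms of \<open>P_Suc\<close> whose indices \<open>n - 1\<close>
  and \<open>n - 2\<close> are truncated.\<close>

lemma \<kappa>_small: "\<kappa> 0 = 0" "\<kappa> (Suc 0) = 0"
  by (simp_all add: \<kappa>_eq)

lemma first_order_relation:
  "[:q + u * p, p:] * pderiv (P n) =
     smult (of_nat n) (smult p (P n) + smult (r (of_nat n - 1)) (P (n - 1)))"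
proof (rule poly_ext)
  fix x
  define Y where "Y = x + u"
  define W where "W = p * Y + q"
  define f where "f n = poly (P n) x" for n
  define d where "d n = poly (pderiv (P n)) x" for n
  \<comment> \<open>\<open>S\<close> collects the lower terms of the recurrence. Their coefficients
    do not depend on x, so \<open>S\<close> acts alike on values of \<open>P\<close> and of its
    derivatives.\<close>
  define S where "S g n = 3 * p^2 * g n + 3 * p * r (of_nat n - 1) * g (n - 1)
         + r (of_nat n - 1) * r (of_nat n - 2) * g (n - 2)" for g :: "nat \<Rightarrow> complex" and n
  have f_Suc: "f (Suc n) = Y * f n + \<kappa> n * S f n" for n
    unfolding f_def P_Suc[of n] S_def Y_def by (simp add: algebra_simps)
  have d_Suc: "d (Suc n) = f n + Y * d n + \<kappa> n * S d n" for n
    unfolding f_def d_def P_Suc[of n] S_def Y_def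
    by (simp add: pderiv_add pderiv_mult pderiv_smult pderiv_pCons algebra_simps)
  have f0: "f 0 = 1" and d0: "d 0 = 0"
    unfolding f_def d_def P_0 by simp_all
  have "W * d n = of_nat n * (p * f n + r (of_nat n - 1) * f (n - 1))" for n
  proof (induction n rule: less_induct)
    case (less n)
    consider "n = 0" | "n = 1" | "n = 2" | m where "n = m + 3"
    proof -
      have "n = 0 \<or> n = 1 \<or> n = 2 \<or> n = (n - 3) + 3" by arith
      then show thesis using that by blast
    qed
    then show ?case
    proof cases
      case 1
      then show ?thesis by (simp add: d0)
    next
      case 2
      then show ?thesis using f_Suc[of 0] d_Suc[of 0]
        by (simp add: f0 d0 \<kappa>_small W_def r_eq)
    next
      case 3
      then show ?thesis using f_Suc[of 0] d_Suc[of 0] f_Suc[of 1] d_Suc[of 1]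
        by (simp add: f0 d0 \<kappa>_small W_def r_eq numeral_2_eq_2 algebra_simps)
    next
      case (4 m)
      \<comment> \<open>For m = 0 the truncated value \<open>f (m - 1)\<close> enters only with a
        factor N - 2 = 0.\<close>
      define N where "N = (of_nat (m + 2) :: complex)"
      have N: "of_nat (m + 1) - 1 = N - 2" "of_nat (m + 1) - 2 = N - 3" "of_nat m - 1 = N - 3"
        "of_nat (m + 1) = N - 1" "of_nat m = N - 2"
        by (simp_all add: N_def)
      have S2: "S g (m + 2) = 3 * p^2 * g (m + 2) + 3 * p * r (N - 1) * g (m + 1) + r (N - 1) * r (N - 2) * g m"
        and S1: "S g (m + 1) = 3 * p^2 * g (m + 1) + 3 * p * r (N - 2) * g m + r (N - 2) * r (N - 3) * g (m - 1)" for g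
        unfolding S_def N N_def[symmetric] by (simp_all add: numeral_2_eq_2)
      have \<kappa>: "\<kappa> (m + 2) = N * (N - 1) / 6" "\<kappa> (m + 1) = (N - 1) * (N - 2) / 6"
        unfolding \<kappa>_eq N N_def[symmetric] by simp_all
      have IH: "W * d (m + 2) = N * (p * f (m + 2) + r (N - 1) * f (m + 1))"
        "W * d (m + 1) = (N - 1) * (p * f (m + 1) + r (N - 2) * f m)"
        "W * d m = (N - 2) * (p * f m + r (N - 3) * f (m - 1))"
        using less[of "m + 2"] less[of "m + 1"] less[of m] 4 unfolding N N_def[symmetric] by simp_all
      have "W * d (Suc (m + 2)) = (N + 1) * (p * f (Suc (m + 2)) + r N * f (m + 2))"
        unfolding W_def
      proof (rule single_commutator_identity[where ?f1.0 = "f (m + 1)" and ?f0.0 = "f m" and ?f00.0 = "f (m - 1)"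
            and ?d2.0 = "d (m + 2)" and ?d1.0 = "d (m + 1)" and ?d0.0 = "d m"], fold W_def)
        show "r t = q - p^3 * t * (t - 1) / 6" for t by (rule r_eq)
        show "Y * f (m + 2) = f (Suc (m + 2)) - N * (N - 1) / 6 *
           (3 * p^2 * f (m + 2) + 3 * p * r (N - 1) * f (m + 1) + r (N - 1) * r (N - 2) * f m)"
          using f_Suc[of "m + 2"] unfolding S2 \<kappa> by simp
        show "Y * f (m + 1) = f (m + 2) - (N - 1) * (N - 2) / 6 *
           (3 * p^2 * f (m + 1) + 3 * p * r (N - 2) * f m + r (N - 2) * r (N - 3) * f (m - 1))"
          using f_Suc[of "m + 1"] unfolding S1 \<kappa> by simp
        show "d (Suc (m + 2)) = f (m + 2) + Y * d (m + 2) + N * (N - 1) / 6 *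
           (3 * p^2 * d (m + 2) + 3 * p * r (N - 1) * d (m + 1) + r (N - 1) * r (N - 2) * d m)"
          using d_Suc[of "m + 2"] unfolding S2 \<kappa> .
      qed (rule IH)+
      moreover have "n = Suc (m + 2)" "of_nat n - 1 = N" "of_nat n = N + 1"
        using 4 by (simp_all add: N_def)
      ultimately show ?thesis by simp
    qed
  qed
  then show "poly ([:q + u * p, p:] * pderiv (P n)) x =
      poly (smult (of_nat n) (smult p (P n) + smult (r (of_nat n - 1)) (P (n - 1)))) x"
    unfolding f_def d_def W_def Y_def by (simp add: algebra_simps)
qed

lemma eigen:
  "[:u, 1:] * pderiv (P n) + smult (1 / 6) ([:q + u * p, p:]^2 * (pderiv ^^ 3) (P n)) = smult (of_nat n) (P n)"
proof (rule poly_ext)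
  fix x
  define Y where "Y = x + u"
  define W where "W = p * Y + q"
  define f where "f n = poly (P n) x" for n
  define d where "d n = poly (pderiv (P n)) x" for n
  define d2 where "d2 n = poly ((pderiv ^^ 2) (P n)) x" for n
  define d3 where "d3 n = poly ((pderiv ^^ 3) (P n)) x" for n
  define S where "S g n = 3 * p^2 * g n + 3 * p * r (of_nat n - 1) * g (n - 1)
         + r (of_nat n - 1) * r (of_nat n - 2) * g (n - 2)" for g :: "nat \<Rightarrow> complex" and n
  have f_Suc: "f (Suc n) = Y * f n + \<kappa> n * S f n" for n
    unfolding f_def P_Suc[of n] S_def Y_def by (simp add: algebra_simps)
  have d_Suc: "d (Suc n) = f n + Y * d n + \<kappa> n * S d n" for n
    unfolding f_def d_def P_Suc[of n] S_def Y_def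
    by (simp add: pderiv_add pderiv_mult pderiv_smult pderiv_pCons algebra_simps)
  have d3_Suc: "d3 (Suc n) = 3 * d2 n + Y * d3 n + \<kappa> n * S d3 n" for n
    unfolding d2_def d3_def P_Suc[of n] S_def Y_def
    by (simp add: numeral_3_eq_3 numeral_2_eq_2 pderiv_add pderiv_mult pderiv_smult pderiv_pCons algebra_simps)
  have d0: "d 0 = 0" and d30: "d3 0 = 0"
    unfolding d_def d3_def P_0 by (simp_all add: numeral_3_eq_3)
  have first: "W * d n = of_nat n * (p * f n + r (of_nat n - 1) * f (n - 1))" for n
    using arg_cong[where f = "\<lambda>R. poly R x", OF first_order_relation[of n]]
    unfolding f_def d_def W_def Y_def by (simp add: algebra_simps)
  \<comment> \<open>Differentiating the first order relation and multiplying by \<open>W\<close>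
    leaves first derivatives at n and n - 1, which \<open>first\<close> eliminates again.\<close>
  have second: "W^2 * d2 n = 6 * \<kappa> n * (p^2 * f n + 2 * p * r (of_nat n - 1) * f (n - 1)
      + r (of_nat n - 1) * r (of_nat n - 2) * f (n - 2))" for n
  proof -
    define N where "N = (of_nat n :: complex)"
    have n1: "N * of_nat (n - 1) = N * (N - 1)" "N * (of_nat (n - 1) - 1) = N * (N - 2)" by (cases n; simp add: N_def)+
    have deriv: "p * d n + W * d2 n = N * (p * d n + r (N - 1) * d (n - 1))"
      using arg_cong[where f = "\<lambda>R. poly (pderiv R) x", OF first_order_relation[of n]]
      by (simp add: pderiv_add pderiv_mult pderiv_smult pderiv_pCons d_def d2_def W_def Y_def N_def numeral_2_eq_2
          algebra_simps)
    have "W^2 * d2 n = W * (p * d n + W * d2 n) - p * (W * d n)"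
      by (simp add: algebra_simps power2_eq_square)
    also have "\<dots> = N * (p * (W * d n) + r (N - 1) * (W * d (n - 1))) - p * (W * d n)"
      unfolding deriv by (simp add: algebra_simps)
    also have "\<dots> = N * (N - 1) * p * (p * f n + r (N - 1) * f (n - 1))
       + r (N - 1) * (N * of_nat (n - 1)) * (p * f (n - 1) + r (of_nat (n - 1) - 1) * f (n - 1 - 1))"
      unfolding first N_def[symmetric] by (simp add: algebra_simps)
    \<comment> \<open>For n \<le> 1 both sides vanish, so the truncated indices do no harm.\<close>
    also have "r (N - 1) * (N * of_nat (n - 1)) * (p * f (n - 1) + r (of_nat (n - 1) - 1) * f (n - 1 - 1))
       = N * (N - 1) * r (N - 1) * (p * f (n - 1) + r (N - 2) * f (n - 2))"
      by (cases n) (simp_all add: N_def numeral_2_eq_2)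
    finally have d2: "W^2 * d2 n = N * (N - 1) * p * (p * f n + r (N - 1) * f (n - 1))
       + N * (N - 1) * r (N - 1) * (p * f (n - 1) + r (N - 2) * f (n - 2))" .
    have \<kappa>6: "6 * \<kappa> n = N * (N - 1)" by (simp add: \<kappa>_eq N_def)
    show ?thesis unfolding d2 \<kappa>6 N_def[symmetric] by (simp add: algebra_simps power2_eq_square)
  qed
  have "Y * d n + W^2 * d3 n / 6 = of_nat n * f n" for n
  proof (induction n rule: less_induct)
    case (less n)
    show ?case
    proof (cases n)
      case 0
      then show ?thesis by (simp add: d0 d30)
    next
      case (Suc m)
      define N where "N = (of_nat m :: complex)"
      have IH: "Y * d m + W^2 * d3 m / 6 = N * f m"
        using less.IH Suc by (simp add: N_def)
      \<comment> \<open>For m \<le> 1 the equations at m - 1 and m - 2 are not both available, but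
        there \<open>\<kappa> m\<close> is 0.\<close>
      have S: "\<kappa> m * (Y * S d m + W^2 * S d3 m / 6) = \<kappa> m * (3 * p^2 * N * f m + 3 * p * r (N - 1) * (N - 1) * f (m - 1)
          + r (N - 1) * r (N - 2) * (N - 2) * f (m - 2))"
      proof (cases "m \<ge> 2")
        case True
        then have "Y * d (m - 1) + W^2 * d3 (m - 1) / 6 = (N - 1) * f (m - 1)"
          "Y * d (m - 2) + W^2 * d3 (m - 2) / 6 = (N - 2) * f (m - 2)"
          using less.IH[of "m - 1"] less.IH[of "m - 2"] Suc by (simp_all add: N_def of_nat_diff)
        note IHs = IH this
        have "Y * S d m + W^2 * S d3 m / 6 = 3 * p^2 * (Y * d m + W^2 * d3 m / 6)
           + 3 * p * r (N - 1) * (Y * d (m - 1) + W^2 * d3 (m - 1) / 6)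
           + r (N - 1) * r (N - 2) * (Y * d (m - 2) + W^2 * d3 (m - 2) / 6)"
          unfolding S_def N_def[symmetric] by (simp add: field_simps)
        then show ?thesis unfolding IHs by simp
      next
        case False
        then have "m = 0 \<or> m = 1" by auto
        then show ?thesis by (auto simp: \<kappa>_small)
      qed
      \<comment> \<open>Moving \<open>Y\<close> past the operator costs \<open>Y * f m\<close> from
        the first derivative and \<open>W^2 * d2 m / 2\<close> from the third.\<close>
      have "Y * d n + W^2 * d3 n / 6 = Y * f m + Y * (Y * d m + W^2 * d3 m / 6) + W^2 * d2 m / 2
         + \<kappa> m * (Y * S d m + W^2 * S d3 m / 6)"
        unfolding Suc d_Suc d3_Suc by (simp add: field_simps)
      \<comment> \<open>By \<open>second\<close>, the commutator adds 1, 2, 3 to the eigenvalues N,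
        N - 1, N - 2 inside \<open>S\<close>, which gives the common value N + 1.\<close>
      also have "\<dots> = (N + 1) * (Y * f m + \<kappa> m * S f m)"
        unfolding IH S unfolding second S_def N_def[symmetric] by (simp add: field_simps)
      also have "\<dots> = of_nat n * f n" by (simp add: Suc f_Suc N_def)
      finally show ?thesis .
    qed
  qed
  then show "poly ([:u, 1:] * pderiv (P n) + smult (1 / 6) ([:q + u * p, p:]^2 * (pderiv ^^ 3) (P n))) x
      = poly (smult (of_nat n) (P n)) x"
    unfolding f_def d_def d3_def W_def Y_def by (simp add: field_simps power2_eq_square)
qed
end

subsection \<open>From the differential equation to the recurrence\<close>

text \<open>The arguments, here and for \<alpha> and \<gamma>, are the coefficients in x of a_1 = s
  y and a_3 = s (c0 + c1 y + c2 y^2) with y = x + u. In these parameters u survives only as a shift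
  of \<beta>.\<close>

lemma beta_coeff_shifted:
  assumes "s \<noteq> 0"
  shows "beta_coeff (s * u) s (s * c2) n = - (c2 / 2) * of_nat n * (of_nat n - 1) - u"
  using assms by (simp add: beta_coeff_def)

lemma alpha_coeff_shifted:
  assumes "s \<noteq> 0"
  shows "alpha_coeff (s * u) s (s * (c1 + 2 * u * c2)) (s * c2) n =
    - (of_nat n * (of_nat n - 1) / 4) * (c1 - c2^2 * (of_nat n - 1) * (of_nat n - 2) / 3)"
proof -
  have cancel: "s * x / (k * s) = x / k" for x k using assms by simp
  have *: "s * (c1 + 2 * u * c2) / (k * s) = (c1 + 2 * u * c2) / k"
     "s * u * (s * c2) / s^2 = u * c2" "k * (s * c2)^2 / (l * s^2) = k * c2^2 / l" "(s * c2)^2 / (l * s^2) = c2^2 / l"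
     "3 * (s * (c1 + 2 * u * c2)) / (4 * s) = 3 * (c1 + 2 * u * c2) / 4"
     "s * c2 * (9 * (s * u) + s * c2) / (6 * s^2) = c2 * (9 * u + c2) / 6" for k l
    using assms by (simp_all only: cancel) (simp_all add: power2_eq_square field_simps)
  show ?thesis unfolding alpha_coeff_def Let_def *
    by (simp add: field_simps power2_eq_square)
qed

lemma gamma_coeff_shifted:
  assumes "s \<noteq> 0"
  shows "gamma_coeff (s * u) s (s * (c0 + u * c1 + u^2 * c2)) (s * (c1 + 2 * u * c2)) (s * c2) n =
    - (of_nat n * (of_nat n + 1) / 6) *
      (c0 - c1 * c2 * (of_nat n - 1)^2 / 6 + c2^3 * of_nat n * (of_nat n - 1)^2 * (of_nat n - 2) / 36)"
proof -
  let ?a01 = "s * u" and ?a03 = "s * (c0 + u * c1 + u^2 * c2)"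
    and ?a13 = "s * (c1 + 2 * u * c2)" and ?a23 = "s * c2"
  define N where "N = (of_nat n :: complex)"
  have cancel: "x / (k * s^3) = y / k" if "x = s^3 * y" for x y k
    using that assms by simp
  \<comment> \<open>Each constant of the formula is homogeneous of degree 0 in s, so s cancels in
    each separately, and u with it.\<close>
  have e1: "- (1 / (3 * s)) * (?a03 + ?a01 * (- s * ?a13 + ?a01 * ?a23) / s^2) = - (c0 / 3)"
    using assms by (simp add: field_simps power2_eq_square)
  have e2: "(s^2 * ?a03 - ?a01 * s * ?a13 + ?a01^2 * ?a23) / (2 * s^3) = c0 / 2"
    by (rule cancel) (simp add: algebra_simps power2_eq_square power3_eq_cube)
  have e3: "(- 18 * ?a03 * s^2 + 6 * ?a13 * s * (3 * ?a01 + ?a23)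
               + ?a23 * (- 18 * ?a01^2 - 12 * ?a23 * ?a01 + ?a23^2)) / (108 * s^3)
        = (- 18 * c0 + 6 * c1 * c2 + c2^3) / 108"
    by (rule cancel) (simp add: algebra_simps power2_eq_square power3_eq_cube)
  have e4: "?a23 * (6 * s * ?a13 + ?a23 * (?a23 - 12 * ?a01)) / (72 * s^3) = c2 * (6 * c1 + c2^2) / 72"
    by (rule cancel) (simp add: algebra_simps power2_eq_square power3_eq_cube)
  have e5: "?a23 * (?a23 * (12 * ?a01 + ?a23) - 6 * s * ?a13) / (216 * s^3) = c2 * (c2^2 - 6 * c1) / 216"
    by (rule cancel) (simp add: algebra_simps power2_eq_square power3_eq_cube)
  have e6: "?a23^3 / (72 * s^3) = c2^3 / 72" "?a23^3 / (216 * s^3) = c2^3 / 216"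
    by (rule cancel, simp add: power_mult_distrib)+
  show ?thesis
    unfolding gamma_coeff_def Let_def e1 e2 e3 e4 e5 e6 N_def[symmetric]
    by (simp add: field_simps power2_eq_square power3_eq_cube power4_eq_xxxx)
qed

section \<open>Subleading coefficients of the eigenpolynomials\<close>

text \<open>With \<open>sub2\<close> and \<open>sub3\<close>: the coefficients one, two and three
  degrees below the top of the monic eigenpolynomial of degree t. A complex t allows neighbouring
  degrees to be compared as polynomials in t.\<close>

definition sub1 :: "complex \<Rightarrow> complex \<Rightarrow> complex" where
  "sub1 c2 t = c2 * t * (t - 1) * (t - 2) / 6"

definition sub2 :: "complex \<Rightarrow> complex \<Rightarrow> complex \<Rightarrow> complex" where
  "sub2 c1 c2 t = (c1 * t * (t - 1) * (t - 2) + c2 * (t - 1) * (t - 2) * (t - 3) * sub1 c2 t) / 12"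

definition sub3 :: "complex \<Rightarrow> complex \<Rightarrow> complex \<Rightarrow> complex \<Rightarrow> complex" where
  "sub3 c0 c1 c2 t = (c0 * t * (t - 1) * (t - 2) + c1 * (t - 1) * (t - 2) * (t - 3) * sub1 c2 t
     + c2 * (t - 2) * (t - 3) * (t - 4) * sub2 c1 c2 t) / 18"

text \<open>Comparison at x^j. The factor n - j is nonzero for j < n, so the coefficients are
  determined from the top down.\<close>

lemma eigen_coeff:
  assumes "[:0, 1:] * pderiv R + smult (1 / 6) ([:c0, c1, c2:] * (pderiv ^^ 3) R) = smult (of_nat n) R"
  shows "(of_nat n - of_nat j) * coeff R j =
    (c0 * (of_nat j + 3) * (of_nat j + 2) * (of_nat j + 1) * coeff R (j + 3)
     + c1 * (of_nat j + 2) * (of_nat j + 1) * of_nat j * coeff R (j + 2)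
     + c2 * (of_nat j + 1) * of_nat j * (of_nat j - 1) * coeff R (j + 1)) / (6 :: complex)"
proof -
  have "of_nat n * coeff R j =
      coeff ([:0, 1:] * pderiv R + smult (1 / 6) ([:c0, c1, c2:] * (pderiv ^^ 3) R)) j"
    unfolding assms by simp
  also have "\<dots> = of_nat j * coeff R j +
    (c0 * (of_nat j + 3) * (of_nat j + 2) * (of_nat j + 1) * coeff R (j + 3)
     + c1 * (of_nat j + 2) * (of_nat j + 1) * of_nat j * coeff R (j + 2)
     + c2 * (of_nat j + 1) * of_nat j * (of_nat j - 1) * coeff R (j + 1)) / 6"
  proof -
    consider "j = 0" | "j = 1" | i where "j = Suc (Suc i)"
    proof -
      have "j = 0 \<or> j = 1 \<or> j = Suc (Suc (j - 2))" by arith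
      then show thesis using that by blast
    qed
    then show ?thesis
      by cases (simp_all add: coeff_pderiv numeral_3_eq_3 numeral_2_eq_2 field_simps)
  qed
  finally show ?thesis by (simp add: algebra_simps)
qed

text \<open>\<open>R n\<close> stands for \<open>P n\<close> written in y, which removes u from the
  operator.\<close>

locale eigen_sequence =
  fixes R :: "nat \<Rightarrow> complex poly" and c0 c1 c2 :: complex
  assumes monic: "monic_poly_seq R"
    and eigen: "[:0, 1:] * pderiv (R n) + smult (1 / 6) ([:c0, c1, c2:] * (pderiv ^^ 3) (R n)) = smult (of_nat n) (R n)"
begin

lemma coeff_top: "coeff (R n) n = 1"
  by (rule monic_poly_seqD(2)[OF monic])

lemma coeff_above: "n < k \<Longrightarrow> coeff (R n) k = 0"
  by (simp add: coeff_eq_0 monic_poly_seqD(1)[OF monic])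

lemma coeff_1: "coeff (R (Suc m)) m = sub1 c2 (of_nat (Suc m))"
  using eigen_coeff[OF eigen, of "Suc m" m]
  by (simp add: coeff_top coeff_above sub1_def algebra_simps)

lemma coeff_2: "coeff (R (m + 2)) m = sub2 c1 c2 (of_nat (m + 2))"
proof -
  have "coeff (R (m + 2)) (m + 1) = sub1 c2 (of_nat m + 2)"
    using coeff_1[of "m + 1"] by (simp add: add.commute)
  then show ?thesis
    using eigen_coeff[OF eigen, of "m + 2" m] coeff_top[of "m + 2"]
    by (simp add: coeff_above sub2_def algebra_simps)
qed

lemma coeff_3: "coeff (R (m + 3)) m = sub3 c0 c1 c2 (of_nat (m + 3))"
proof -
  have "coeff (R (m + 3)) (m + 2) = sub1 c2 (of_nat m + 3)"
    using coeff_1[of "m + 2"] by (simp add: numeral_3_eq_3 add.commute)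
  moreover have "coeff (R (m + 3)) (m + 1) = sub2 c1 c2 (of_nat m + 3)"
    using coeff_2[of "m + 1"] by (simp add: numeral_3_eq_3 add.commute)
  ultimately show ?thesis
    using eigen_coeff[OF eigen, of "m + 3" m] coeff_top[of "m + 3"]
    by (simp add: sub3_def algebra_simps)
qed

section \<open>Recurrence coefficients by comparison\<close>

context
  fixes b a g :: "nat \<Rightarrow> complex"
  assumes rec: "has_recurrence R b a g"
begin

lemma mult_x: "pCons 0 (R n) = R (Suc n) + smult (b n) (R n)
       + (if n = 0 then 0 else smult (a n) (R (n - 1)))
       + (if n \<le> 1 then 0 else smult (g (n - 1)) (R (n - 2)))"
  using rec unfolding has_recurrence_iff by blast

text \<open>The comparison is one degree below the top of x \<open>R n\<close>; two degrees below
  give \<alpha>, three give \<gamma>.\<close>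

lemma beta_eq: "b n = - (c2 / 2) * of_nat n * (of_nat n - 1)"
proof -
  have "coeff (pCons 0 (R n)) n = sub1 c2 (of_nat n)"
    by (cases n) (simp_all add: coeff_1 sub1_def)
  moreover have "coeff (pCons 0 (R n)) n = sub1 c2 (of_nat n + 1) + b n"
    unfolding mult_x using coeff_1[of n] coeff_top[of n] by (simp add: coeff_above add.commute)
  ultimately have "b n = sub1 c2 (of_nat n) - sub1 c2 (of_nat n + 1)" by (simp add: algebra_simps)
  also have "\<dots> = - (c2 / 2) * of_nat n * (of_nat n - 1)" by (simp add: sub1_def field_simps)
  finally show ?thesis .
qed

lemma alpha_eq:
  assumes "n \<ge> 1"
  shows "a n = - (of_nat n * (of_nat n - 1) / 4) * (c1 - c2^2 * (of_nat n - 1) * (of_nat n - 2) / 3)"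
proof -
  obtain m where n: "n = Suc m" using assms by (cases n) auto
  define N where "N = (of_nat n :: complex)"
  have "coeff (pCons 0 (R n)) m = sub2 c1 c2 N"
  proof (cases m)
    case 0
    then show ?thesis by (simp add: n N_def sub2_def sub1_def)
  next
    case (Suc k)
    then have "n = k + 2" "N = of_nat (k + 2)" by (simp_all add: n N_def)
    then show ?thesis using coeff_2[of k] Suc by simp
  qed
  moreover have "coeff (pCons 0 (R n)) m = sub2 c1 c2 (N + 1) + b n * sub1 c2 N + a n"
  proof -
    have "coeff (R (Suc n)) m = sub2 c1 c2 (N + 1)"
      using coeff_2[of m] by (simp add: n N_def add.commute)
    moreover have "coeff (R n) m = sub1 c2 N"
      using coeff_1[of m] by (simp add: n N_def)
    ultimately show ?thesis unfolding mult_x[of n] using coeff_top[of m] by (simp add: n coeff_above)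
  qed
  ultimately have "a n = sub2 c1 c2 N - sub2 c1 c2 (N + 1) - b n * sub1 c2 N" by (simp add: algebra_simps)
  also have "\<dots> = - (N * (N - 1) / 4) * (c1 - c2^2 * (N - 1) * (N - 2) / 3)"
    unfolding beta_eq N_def[symmetric] sub2_def sub1_def by (simp add: field_simps power2_eq_square)
  finally show ?thesis unfolding N_def .
qed

lemma gamma_eq:
  assumes "n \<ge> 1"
  shows "g n = - (of_nat n * (of_nat n + 1) / 6) *
      (c0 - c1 * c2 * (of_nat n - 1)^2 / 6 + c2^3 * of_nat n * (of_nat n - 1)^2 * (of_nat n - 2) / 36)"
proof -
  obtain m where n: "n = Suc m" using assms by (cases n) auto
  define N where "N = (of_nat n :: complex)"
  have N: "of_nat (Suc n) = N + 1" by (simp add: N_def)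
  \<comment> \<open>For m = 0 the left side is 0, and \<open>sub3\<close> vanishes at 2.\<close>
  have "coeff (pCons 0 (R (Suc n))) m = sub3 c0 c1 c2 (N + 1)"
  proof (cases m)
    case 0
    then show ?thesis by (simp add: n N_def sub3_def sub2_def sub1_def)
  next
    case (Suc k)
    then have *: "Suc n = k + 3" "N + 1 = of_nat (k + 3)" by (simp_all add: n N_def)
    show ?thesis unfolding * Suc using coeff_3[of k] by simp
  qed
  moreover have "coeff (pCons 0 (R (Suc n))) m = sub3 c0 c1 c2 (N + 2) + b (Suc n) * sub2 c1 c2 (N + 1)
      + a (Suc n) * sub1 c2 N + g n"
  proof -
    have "coeff (R (Suc (Suc n))) m = sub3 c0 c1 c2 (N + 2)"
      using coeff_3[of m] by (simp add: n N_def add.commute numeral_3_eq_3)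
    moreover have "coeff (R (Suc n)) m = sub2 c1 c2 (N + 1)"
      using coeff_2[of m] by (simp add: n N_def add.commute)
    moreover have "coeff (R n) m = sub1 c2 N"
      using coeff_1[of m] by (simp add: n N_def)
    ultimately show ?thesis unfolding mult_x[of "Suc n"] using coeff_top[of m] by (simp add: n)
  qed
  ultimately have "g n = sub3 c0 c1 c2 (N + 1) - sub3 c0 c1 c2 (N + 2) - b (Suc n) * sub2 c1 c2 (N + 1)
      - a (Suc n) * sub1 c2 N" by (simp add: algebra_simps)
  also have "b (Suc n) = - (c2 / 2) * (N + 1) * N" unfolding beta_eq N by simp
  also have "a (Suc n) = - ((N + 1) * N / 4) * (c1 - c2^2 * N * (N - 1) / 3)"
    using alpha_eq[of "Suc n"] unfolding N by simp
  also have "sub3 c0 c1 c2 (N + 1) - sub3 c0 c1 c2 (N + 2) - - (c2 / 2) * (N + 1) * N * sub2 c1 c2 (N + 1)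
      - - ((N + 1) * N / 4) * (c1 - c2^2 * N * (N - 1) / 3) * sub1 c2 N
    = - (N * (N + 1) / 6) * (c0 - c1 * c2 * (N - 1)^2 / 6 + c2^3 * N * (N - 1)^2 * (N - 2) / 36)"
    unfolding sub3_def sub2_def sub1_def by (simp add: field_simps power2_eq_square power3_eq_cube)
  finally show ?thesis unfolding N_def .
qed

text \<open>Four degrees below the top all recurrence coefficients are already fixed, so the
  comparison becomes a constraint.\<close>

lemma discriminant_zero: "c1^2 = 4 * c0 * c2"
proof -
  \<comment> \<open>Since \<open>R 2\<close> has no linear term, \<open>g 3\<close> drops out of the
    comparison.\<close>
  have R2: "coeff (R 2) 1 = 0" using coeff_1[of 1] by (simp add: sub1_def numeral_2_eq_2)
  have R3: "coeff (R 3) 1 = c1 / 2" using coeff_2[of 1] by (simp add: sub2_def sub1_def numeral_3_eq_3)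
  have R4: "coeff (R 4) 1 = sub3 c0 c1 c2 4" "coeff (R 4) 3 = sub1 c2 4"
    using coeff_3[of 1] coeff_1[of 3] by simp_all
  have R5: "coeff (R 5) 4 = sub1 c2 5" "coeff (R 5) 3 = sub2 c1 c2 5"
    using coeff_1[of 4] coeff_2[of 3] by simp_all
  have "coeff (R 4) 0 = c0 * c2"
    using eigen_coeff[OF eigen, of 4 0] R4 by (simp add: sub1_def)
  moreover have "coeff (R 5) 1 = c0 * sub1 c2 5 + c1 * sub2 c1 c2 5 / 4"
  proof -
    have "24 * coeff (R 5) 1 = 24 * (c0 * sub1 c2 5 + c1 * sub2 c1 c2 5 / 4)"
      using eigen_coeff[OF eigen, of 5 1] R5[unfolded numeral_3_eq_3] by (simp add: field_simps)
    then show ?thesis unfolding mult_cancel_left by simp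
  qed
  moreover have "coeff (pCons 0 (R 4)) 1 = coeff (R 5) 1 + b 4 * coeff (R 4) 1 + a 4 * coeff (R 3) 1"
    unfolding mult_x[of 4] using R2 by simp
  moreover have "b 4 = - 6 * c2" "a 4 = - 3 * (c1 - 2 * c2^2)"
    using beta_eq[of 4] alpha_eq[of 4] by simp_all
  ultimately have "c0 * c2 = c0 * sub1 c2 5 + c1 * sub2 c1 c2 5 / 4 - 6 * c2 * sub3 c0 c1 c2 4
     - 3 * (c1 - 2 * c2^2) * (c1 / 2)"
    unfolding R3 R4 by (simp add: algebra_simps)
  then show ?thesis
    unfolding sub3_def sub2_def sub1_def by (simp add: field_simps power2_eq_square)
qed

end
end

subsection \<open>The equivalence\<close>

text \<open>Substituting x - u rewrites \<open>P\<close> in the variable y, and x = y - u affects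
  only the diagonal coefficient.\<close>

lemma has_recurrence_shift:
  assumes "has_recurrence P \<beta> \<alpha> \<gamma>"
  shows "has_recurrence (\<lambda>n. P n \<circ>\<^sub>p [:- u, 1:]) (\<lambda>n. \<beta> n + u) \<alpha> \<gamma>"
proof -
  have P0: "P 0 = 1" and rec: "pCons 0 (P n) = P (Suc n) + smult (\<beta> n) (P n)
       + (if n = 0 then 0 else smult (\<alpha> n) (P (n - 1)))
       + (if n \<le> 1 then 0 else smult (\<gamma> (n - 1)) (P (n - 2)))" for n
    using assms unfolding has_recurrence_iff by blast+
  have "pCons 0 (P n \<circ>\<^sub>p [:- u, 1:]) = pCons 0 (P n) \<circ>\<^sub>p [:- u, 1:] + smult u (P n \<circ>\<^sub>p [:- u, 1:])" for n
    by (simp add: pcompose_pCons)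
  then show ?thesis
    unfolding has_recurrence_iff rec
    by (auto simp: P0 pcompose_add pcompose_smult smult_add_left one_pCons)
qed

lemma pderiv_funpow_pcompose_shift:
  "(pderiv ^^ k) (p \<circ>\<^sub>p [:a, 1:]) = ((pderiv ^^ k) p \<circ>\<^sub>p [:a, 1:] :: 'a::idom poly)"
  by (induction k) (simp_all add: pderiv_pcompose pderiv_pCons)

lemma monic_poly_seq_shift:
  assumes "monic_poly_seq P"
  shows "monic_poly_seq (\<lambda>n. P n \<circ>\<^sub>p [:a, 1:])"
proof -
  have "degree (P n \<circ>\<^sub>p [:a, 1:]) = n" "lead_coeff (P n \<circ>\<^sub>p [:a, 1:]) = 1" for n
    using monic_poly_seqD[OF assms] lead_coeff_comp[of "[:a, 1:]" "P n"] by (simp_all add: degree_pcompose)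
  then show ?thesis unfolding monic_poly_seq_def by blast
qed

text \<open>The operator is a00 plus s times the normalized one, and the eigenvalue splits alike, so
  a00 and s cancel.\<close>

lemma J_op_eigen_iff:
  assumes "s \<noteq> 0"
  shows "J_op [:a00:] [:s * u, s:] [:s * e0, s * e1, s * e2:] p = smult (lam a00 s n) p \<longleftrightarrow>
    [:u, 1:] * pderiv p + smult (1 / 6) ([:e0, e1, e2:] * (pderiv ^^ 3) p) = smult (of_nat n) p"
proof -
  have "[:s * u, s:] = smult s [:u, 1:]" "[:s * e0, s * e1, s * e2:] = smult s [:e0, e1, e2:]" by simp_all
  then have "J_op [:a00:] [:s * u, s:] [:s * e0, s * e1, s * e2:] p =
      smult a00 p + smult s ([:u, 1:] * pderiv p + smult (1 / 6) ([:e0, e1, e2:] * (pderiv ^^ 3) p))"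
    by (simp only: J_op_def mult_smult_left) (simp add: fact_numeral smult_add_right algebra_simps)
  moreover have "smult (lam a00 s n) p = smult a00 p + smult s (smult (of_nat n) p)"
    by (simp add: lam_def smult_add_left mult.commute)
  moreover have "smult s X = smult s Y \<longleftrightarrow> X = Y" for X Y
    using smult_cancel[OF assms] by blast
  ultimately show ?thesis by (simp only: add_left_cancel)
qed

lemma eigen_imp_recurrence:
  assumes s: "s \<noteq> 0" and P: "two_orthogonal P"
    and eigen: "\<And>n. [:u, 1:] * pderiv (P n)
      + smult (1 / 6) ([:c0 + u * c1 + u^2 * c2, c1 + 2 * u * c2, c2:] * (pderiv ^^ 3) (P n)) = smult (of_nat n) (P n)"
  defines "\<gamma> \<equiv> gamma_coeff (s * u) s (s * (c0 + u * c1 + u^2 * c2)) (s * (c1 + 2 * u * c2)) (s * c2)"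
  shows "c1^2 = 4 * c0 * c2"
    and "has_recurrence P (beta_coeff (s * u) s (s * c2))
      (alpha_coeff (s * u) s (s * (c1 + 2 * u * c2)) (s * c2)) \<gamma>"
    and "n \<ge> 1 \<Longrightarrow> \<gamma> n \<noteq> 0"
proof -
  \<comment> \<open>Some recurrence with nonzero \<open>g\<close> exists by 2-orthogonality;
    identifying its coefficients also makes the displayed \<gamma> nonzero.\<close>
  obtain b a g where rec: "has_recurrence P b a g" and g: "\<And>n. n \<ge> 1 \<Longrightarrow> g n \<noteq> 0"
    using two_orthogonal_imp_has_recurrence[OF P] by blast
  define R where "R n = P n \<circ>\<^sub>p [:- u, 1:]" for n
  interpret eigen_sequence R c0 c1 c2
  proof
    show "monic_poly_seq R"
      unfolding R_def by (intro monic_poly_seq_shift has_recurrence_monic[OF rec])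
    fix n
    have "[:u, 1:] \<circ>\<^sub>p [:- u, 1:] = [:0, 1:]"
      "[:c0 + u * c1 + u^2 * c2, c1 + 2 * u * c2, c2:] \<circ>\<^sub>p [:- u, 1:] = [:c0, c1, c2:]"
      by (simp_all add: pcompose_pCons algebra_simps power2_eq_square)
    moreover have "pderiv (R n) = pderiv (P n) \<circ>\<^sub>p [:- u, 1:]"
      using pderiv_funpow_pcompose_shift[of 1] by (simp add: R_def)
    ultimately show "[:0, 1:] * pderiv (R n) + smult (1 / 6) ([:c0, c1, c2:] * (pderiv ^^ 3) (R n)) = smult (of_nat n) (R n)"
      using arg_cong[where f = "\<lambda>p. p \<circ>\<^sub>p [:- u, 1:]", OF eigen[of n]]
      by (simp only: pcompose_add pcompose_mult pcompose_smult R_def pderiv_funpow_pcompose_shift)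
  qed
  have R: "has_recurrence R (\<lambda>n. b n + u) a g"
    unfolding R_def by (rule has_recurrence_shift[OF rec])
  show "c1^2 = 4 * c0 * c2" by (rule discriminant_zero[OF R])
  have \<gamma>: "g n = \<gamma> n" if "n \<ge> 1" for n
    unfolding \<gamma>_def gamma_coeff_shifted[OF s] using gamma_eq[OF R that] .
  have "b n = beta_coeff (s * u) s (s * c2) n" for n
    unfolding beta_coeff_shifted[OF s] beta_eq[OF R, symmetric] by simp
  moreover have "a n = alpha_coeff (s * u) s (s * (c1 + 2 * u * c2)) (s * c2) n" if "n \<ge> 1" for n
    unfolding alpha_coeff_shifted[OF s] using alpha_eq[OF R that] .
  ultimately show "has_recurrence P (beta_coeff (s * u) s (s * c2))
      (alpha_coeff (s * u) s (s * (c1 + 2 * u * c2)) (s * c2)) \<gamma>"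
    using rec \<gamma> has_recurrence_cong by blast
  show "n \<ge> 1 \<Longrightarrow> \<gamma> n \<noteq> 0" using g \<gamma> by metis
qed

text \<open>If c2 = 0, the assumption forces c1 = 0, so p = 0 and q is a square root of c0.
  Otherwise p is a square root of c2, and c1 determines q.\<close>

lemma discriminant_zero_imp_square:
  fixes c0 c1 c2 :: complex
  assumes "c1^2 = 4 * c0 * c2"
  obtains p q where "c2 = p^2" "c1 = 2 * p * q" "c0 = q^2"
proof (cases "c2 = 0")
  case True
  show thesis by (rule that[of 0 "csqrt c0"]) (use True assms in simp_all)
next
  case False
  define p where "p = csqrt c2"
  have p: "p^2 = c2" "p \<noteq> 0" using False by (auto simp: p_def)
  show thesis
  proof (rule that[of p "c1 / (2 * p)"])
    show "c0 = (c1 / (2 * p))^2"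
      using assms False by (simp add: power_divide power_mult_distrib p(1))
  qed (use p in simp_all)
qed

lemma recurrence_imp_eigen:
  assumes s: "s \<noteq> 0" and disc: "c1^2 = 4 * c0 * c2"
    and rec: "has_recurrence P (beta_coeff (s * u) s (s * c2))
      (alpha_coeff (s * u) s (s * (c1 + 2 * u * c2)) (s * c2))
      (gamma_coeff (s * u) s (s * (c0 + u * c1 + u^2 * c2)) (s * (c1 + 2 * u * c2)) (s * c2))"
      (is "has_recurrence P ?\<beta> ?\<alpha> ?\<gamma>")
  shows "[:u, 1:] * pderiv (P n)
      + smult (1 / 6) ([:c0 + u * c1 + u^2 * c2, c1 + 2 * u * c2, c2:] * (pderiv ^^ 3) (P n)) = smult (of_nat n) (P n)"
proof -
  obtain p q where pq: "c2 = p^2" "c1 = 2 * p * q" "c0 = q^2"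
    using disc by (rule discriminant_zero_imp_square)
  define r where "r t = q - p^3 * t * (t - 1) / 6" for t
  define \<kappa> where "\<kappa> n = (of_nat n * (of_nat n - 1) / 6 :: complex)" for n
  have P0: "P 0 = 1" and mult_x: "pCons 0 (P n) = P (Suc n) + smult (?\<beta> n) (P n)
       + (if n = 0 then 0 else smult (?\<alpha> n) (P (n - 1)))
       + (if n \<le> 1 then 0 else smult (?\<gamma> (n - 1)) (P (n - 2)))" for n
    using rec unfolding has_recurrence_iff by blast+
  have \<beta>: "?\<beta> n = - (\<kappa> n * (3 * p^2)) - u" for n
    unfolding beta_coeff_shifted[OF s] \<kappa>_def pq by simp
  have \<alpha>: "?\<alpha> n = - (\<kappa> n * (3 * p * r (of_nat n - 1)))" for n
    unfolding alpha_coeff_shifted[OF s] \<kappa>_def r_def pq by (simp add: field_simps power2_eq_square power3_eq_cube)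
  \<comment> \<open>The coefficient of \<open>P (n - 2)\<close> has index n - 1; with this shift it
    carries the same factor \<open>\<kappa> n\<close> as the others.\<close>
  have \<gamma>: "?\<gamma> (n - 1) = - (\<kappa> n * (r (of_nat n - 1) * r (of_nat n - 2)))" if n2: "n \<ge> 2" for n
  proof -
    obtain m where n: "n = Suc m" using n2 by (cases n) auto
    show ?thesis unfolding gamma_coeff_shifted[OF s] \<kappa>_def r_def pq n
      by (simp add: field_simps power2_eq_square power3_eq_cube)
  qed
  interpret factored_recurrence P p q u r \<kappa>
  proof
    fix n
    have "P (Suc n) = pCons 0 (P n) - smult (?\<beta> n) (P n)
       - (if n = 0 then 0 else smult (?\<alpha> n) (P (n - 1)))
       - (if n \<le> 1 then 0 else smult (?\<gamma> (n - 1)) (P (n - 2)))"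
      unfolding mult_x by simp
    also have "(if n = 0 then 0 else smult (?\<alpha> n) (P (n - 1))) = smult (?\<alpha> n) (P (n - 1))"
      unfolding \<alpha> by (simp add: \<kappa>_def)
    also have "(if n \<le> 1 then 0 else smult (?\<gamma> (n - 1)) (P (n - 2))) =
        smult (- (\<kappa> n * (r (of_nat n - 1) * r (of_nat n - 2)))) (P (n - 2))"
    proof (cases "n \<le> 1")
      case True
      then have "n = 0 \<or> n = 1" by auto
      then show ?thesis by (auto simp: \<kappa>_def)
    next
      case False
      then show ?thesis using \<gamma>[of n] by simp
    qed
    finally show "P (Suc n) = [:u, 1:] * P n + smult (\<kappa> n)
       (smult (3 * p^2) (P n) + smult (3 * p * r (of_nat n - 1)) (P (n - 1))
         + smult (r (of_nat n - 1) * r (of_nat n - 2)) (P (n - 2)))"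
      unfolding \<beta> \<alpha> by (simp add: smult_add_right smult_add_left smult_diff_left algebra_simps)
  qed (simp_all add: r_def \<kappa>_def P0)
  have "[:c0 + u * c1 + u^2 * c2, c1 + 2 * u * c2, c2:] = [:q + u * p, p:]^2"
    unfolding pq by (simp add: power2_eq_square algebra_simps)
  then show ?thesis using eigen by simp
qed

theorem theorem4p4:
  fixes a00 a01 a11 a03 a13 a23 :: complex
    and J :: "complex poly \<Rightarrow> complex poly"
    and \<beta> \<alpha> \<gamma> :: "nat \<Rightarrow> complex"
  assumes a11: "a11 \<noteq> 0"
    and lam: "\<forall>n. lam a00 a11 n \<noteq> 0"
    and J: "J = J_op [:a00:] [:a01, a11:] [:a03, a13, a23:]"
    and beta: "\<beta> = beta_coeff a01 a11 a23"
    and alpha: "\<alpha> = alpha_coeff a01 a11 a13 a23"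
    and gamma: "\<gamma> = gamma_coeff a01 a11 a03 a13 a23"
  shows
    "(\<forall>P. two_orthogonal P \<and> (\<forall>n. J (P n) = smult (lam a00 a11 n) (P n)) \<longrightarrow>
        a13^2 - 4 * a23 * a03 = 0 \<and> has_recurrence P \<beta> \<alpha> \<gamma> \<and> (\<forall>n\<ge>1. \<gamma> n \<noteq> 0)) \<and>
     (a13^2 - 4 * a23 * a03 = 0 \<and> (\<forall>n\<ge>1. \<gamma> n \<noteq> 0) \<longrightarrow>
        (\<exists>!P. has_recurrence P \<beta> \<alpha> \<gamma>) \<and>
        (\<forall>P. has_recurrence P \<beta> \<alpha> \<gamma> \<longrightarrow>
           two_orthogonal P \<and> (\<forall>n. J (P n) = smult (lam a00 a11 n) (P n))))"
proof -
  \<comment> \<open>The equations a_1 = a11 y and a_3 = a11 (c0 + c1 y + c2 y^2) are solved for u,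
    c2, c1, c0 in turn.\<close>
  define u where "u = a01 / a11"
  define c2 where "c2 = a23 / a11"
  define c1 where "c1 = a13 / a11 - 2 * u * c2"
  define c0 where "c0 = a03 / a11 - u * c1 - u^2 * c2"
  have a: "a01 = a11 * u" "a23 = a11 * c2" "a13 = a11 * (c1 + 2 * u * c2)"
      "a03 = a11 * (c0 + u * c1 + u^2 * c2)"
    using a11 by (simp_all add: u_def c2_def c1_def c0_def)
  \<comment> \<open>The discriminant is invariant under translation of the variable and scales
    quadratically.\<close>
  have "a13^2 - 4 * a23 * a03 = a11^2 * (c1^2 - 4 * c0 * c2)"
    unfolding a by (simp add: algebra_simps power2_eq_square)
  then have disc: "a13^2 - 4 * a23 * a03 = 0 \<longleftrightarrow> c1^2 = 4 * c0 * c2" using a11 by simp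
  have eigen: "(\<forall>n. J (P n) = smult (lam a00 a11 n) (P n)) \<longleftrightarrow> (\<forall>n. [:u, 1:] * pderiv (P n)
      + smult (1 / 6) ([:c0 + u * c1 + u^2 * c2, c1 + 2 * u * c2, c2:] * (pderiv ^^ 3) (P n)) = smult (of_nat n) (P n))"
    for P unfolding J a using J_op_eigen_iff[OF a11] by blast
  show ?thesis
  proof (intro conjI allI impI)
    fix P assume P: "two_orthogonal P \<and> (\<forall>n. J (P n) = smult (lam a00 a11 n) (P n))"
    note * = eigen_imp_recurrence[OF a11, of P u c0 c1 c2, folded a, folded beta alpha gamma]
    show "a13^2 - 4 * a23 * a03 = 0" unfolding disc using * P eigen by blast
    show "has_recurrence P \<beta> \<alpha> \<gamma>" using * P eigen by blast
    show "\<gamma> n \<noteq> 0" if "n \<ge> 1" for n using * P eigen that by blast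
  next
    assume "a13^2 - 4 * a23 * a03 = 0 \<and> (\<forall>n\<ge>1. \<gamma> n \<noteq> 0)"
    then have d: "c1^2 = 4 * c0 * c2" and \<gamma>: "\<And>n. n \<ge> 1 \<Longrightarrow> \<gamma> n \<noteq> 0" using disc by auto
    show "\<exists>!P. has_recurrence P \<beta> \<alpha> \<gamma>" unfolding has_recurrence_iff_rec_polys by blast
    fix P assume P: "has_recurrence P \<beta> \<alpha> \<gamma>"
    show "two_orthogonal P" by (rule has_recurrence_imp_two_orthogonal[OF P \<gamma>])
    have "\<forall>n. J (P n) = smult (lam a00 a11 n) (P n)"
      unfolding eigen using recurrence_imp_eigen[OF a11 d] P unfolding beta alpha gamma a by blast
    then show "J (P n) = smult (lam a00 a11 n) (P n)" for n by blast
  qed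
qed

end
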